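(* Define integers $\gamma(k,i)$ for $k\ge 0$ and $i\in\mathbb{Z}$ by $\gamma(0,0)=1$, $\gamma(0,i)=0$ for $i\neq 0$, and, for $k\ge 0$, $$\gamma(k+1,i)=\binom{i-k-1}{2}\gamma(k,i-1)+(i-1)(i-k-2)\gamma(k,i-2)+\binom{i-1}{2}\gamma(k,i-3).$$ Then: (1) for every integer $k\ge 1$ and every integer $n\geq 1$, $$\mathrm{LS}(n+k,n)=2^k\sum_{i=k+2}^{3k}\gamma(k,i)\binom{n+k+1}{i},$$ and the coefficients $\gamma(k,i)$ are positive integers for $k+2\le i\le 3k$; (2) the polynomials $\gamma_k(x)=\sum_{i}\gamma(k,i)x^i$ satisfy, for $k\ge 0$, $$\gamma_{k+1}(x)=\left(\frac{k(k+1)}{2}-kx+x^2\right)x\gamma_k(x)-\left(k+(k-2)x-2x^2\right)x^2\gamma_k'(x)+\frac{(1+x)^2x^3}{2}\gamma_k''(x),$$ with $\gamma_0(x)=1$, $\gamma_1(x)=x^3$ and $\gamma_2(x)=x^4+8x^5+10x^6$.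
   Context: The Legendre-Stirling numbers of the second kind $\mathrm{LS}(n,k)$ ($n,k\ge 0$) are defined by the recurrence $\mathrm{LS}(n,k)=\mathrm{LS}(n-1,k-1)+k(k+1)\mathrm{LS}(n-1,k)$ with initial conditions $\mathrm{LS}(n,0)=\delta_{n,0}$ and $\mathrm{LS}(0,k)=\delta_{0,k}$. For an integer $m\ge 0$, $\binom{y}{m}=\frac{y(y-1)\cdots(y-m+1)}{m!}$ (so $\binom{y}{2}=y(y-1)/2$ for every integer $y$). *)

theory Defs
  imports "HOL-Computational_Algebra.Polynomial"
begin

(* Legendre-Stirling numbers of the second kind; the recurrence in the usual indexing is LS_rec. *)
fun LS :: "nat \<Rightarrow> nat \<Rightarrow> nat" where
  "LS 0 k = (if k = 0 then 1 else 0)"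
| "LS (Suc n) 0 = 0"
| "LS (Suc n) (Suc k) = LS n k + (k + 1) * (k + 2) * LS n (Suc k)"

lemma LS_0_right: "LS n 0 = (if n = 0 then 1 else 0)"
  by (cases n) simp_all

lemma LS_rec:
  assumes "n \<ge> 1" "k \<ge> 1"
  shows "LS n k = LS (n - 1) (k - 1) + k * (k + 1) * LS (n - 1) k"
  using assms by (cases n; cases k) simp_all

(* gchoose is constrained to fields here, so on int it would be read as a coercion to real. *)
definition ibinom2 :: "int \<Rightarrow> int" where
  "ibinom2 y = y * (y - 1) div 2"

lemma two_ibinom2: "2 * ibinom2 y = y * (y - 1)"
  by (simp add: ibinom2_def)

lemma of_int_ibinom2: "of_int (ibinom2 y) = ((of_int y :: rat) gchoose 2)"
proof -
  have "2 * of_int (ibinom2 y) = (of_int y * (of_int y - 1) :: rat)"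
    using arg_cong[OF two_ibinom2[of y], of "of_int :: int \<Rightarrow> rat"] by simp
  then show ?thesis
    by (simp add: gbinomial_prod_rev numeral_2_eq_2)
qed

primrec gam :: "nat \<Rightarrow> int \<Rightarrow> int" where
  "gam 0 i = (if i = 0 then 1 else 0)"
| "gam (Suc k) i =
     ibinom2 (i - int k - 1) * gam k (i - 1)
     + (i - 1) * (i - int k - 2) * gam k (i - 2)
     + ibinom2 (i - 1) * gam k (i - 3)"

lemma gam_eq_0: "i < 0 \<or> i > 3 * int k \<Longrightarrow> gam k i = 0"
  by (induction k arbitrary: i) auto

(* The sum over all integers i is written over the support of gam k, which lies in {0..3k} by
   gam_eq_0: the sum is finite and nat i does not truncate. *)
definition gam_poly :: "nat \<Rightarrow> rat poly" where
  "gam_poly k = (\<Sum>i | gam k i \<noteq> 0. monom (of_int (gam k i)) (nat i))"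

lemma finite_gam_support: "finite {i. gam k i \<noteq> 0}"
  by (rule finite_subset[of _ "{0..3 * int k}"]) (use gam_eq_0 in force)+

lemma coeff_gam_poly: "coeff (gam_poly k) j = of_int (gam k (int j))"
proof -
  have "coeff (gam_poly k) j =
      (\<Sum>i | gam k i \<noteq> 0. if i = int j then of_int (gam k i) else 0)"
    unfolding gam_poly_def coeff_sum
  proof (rule sum.cong)
    fix i assume "i \<in> {i. gam k i \<noteq> 0}"
    then have "i \<ge> 0" using gam_eq_0[of i k] by force
    then show "coeff (monom (of_int (gam k i)) (nat i)) j
        = (if i = int j then of_int (gam k i) else (0::rat))"
      by (auto simp: nat_eq_iff)
  qed simp
  also have "\<dots> = of_int (gam k (int j))"
    using finite_gam_support[of k] by (simp add: sum.delta)
  finally show ?thesis .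
qed

end

theory Submission
  imports Defs
begin

text \<open>With \<open>N = n + k + 1\<close>, the recurrence for \<open>f\<^sub>k(n) = LS(n + k, n)\<close> reads
  \<open>f\<^sub>k\<^sub>+\<^sub>1(n) - f\<^sub>k\<^sub>+\<^sub>1(n - 1) = (N - k - 1) (N - k) f\<^sub>k(n)\<close>, and by Pascal's rule the claimed formula has
  the difference \<open>\<Sum>\<^sub>i 2\<^sup>k\<^sup>+\<^sup>1 \<gamma>(k + 1, i) binom(N, i - 1)\<close>. Expanding \<open>(N - k - 1) (N - k) binom(N, i)\<close>
  in \<open>binom(N, i)\<close>, \<open>binom(N, i + 1)\<close>, \<open>binom(N, i + 2)\<close> gives exactly the recurrence for \<open>\<gamma>\<close>. The
  differences fix the formula because both sides vanish at \<open>n = 0\<close> when \<open>k \<ge> 1\<close>, the support of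
  \<open>\<gamma>(k, \<cdot>)\<close> starting at \<open>k + 2\<close>. The identity (2) compares coefficients.\<close>

lemma ibinom2_0 [simp]: "ibinom2 0 = 0"
  and ibinom2_1 [simp]: "ibinom2 1 = 0"
  by (simp_all add: ibinom2_def)

lemma of_int_ibinom2_rat: "(of_int (ibinom2 y) :: rat) = of_int y * (of_int y - 1) / 2"
  using arg_cong[OF two_ibinom2[of y], of "of_int :: int \<Rightarrow> rat"] by simp

lemma ibinom2_pos: "y \<ge> 2 \<Longrightarrow> ibinom2 y > 0"
  using two_ibinom2[of y] mult_pos_pos[of y "y - 1"] by linarith

lemma gam_1: "gam (Suc 0) i = (if i = 3 then 1 else 0)"
  by (auto simp: ibinom2_def)

text \<open>Each step of the recurrence raises the index by at least 1. Stated at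
  \<open>Suc k\<close> because the lower bound fails at level 0, where
  \<open>gam 0 0 = 1\<close>.\<close>

lemma gam_eq_0_lower: "i < int k + 3 \<Longrightarrow> gam (Suc k) i = 0"
proof (induction k arbitrary: i)
  case 0
  then show ?case by (simp only: gam_1) simp
next
  case (Suc k)
  then show ?case by (subst gam.simps(2)) (simp del: gam.simps)
qed

text \<open>On this range all three coefficients of the recurrence are positive, so one predecessor
  inside the support suffices.\<close>

lemma gam_pos: "int k + 3 \<le> i \<Longrightarrow> i \<le> 3 * int k + 3 \<Longrightarrow> gam (Suc k) i > 0"
proof (induction k arbitrary: i)
  case 0
  then show ?case by (simp only: gam_1) simp
next
  case (Suc k)
  have nonneg: "gam (Suc k) j \<ge> 0" for j
    using Suc.IH[of j] gam_eq_0_lower[of j k] gam_eq_0[of j "Suc k"]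
    by (cases "int k + 3 \<le> j \<and> j \<le> 3 * int k + 3") force+
  define a b c where "a = ibinom2 (i - int (Suc k) - 1)" and "b = (i - 1) * (i - int (Suc k) - 2)"
    and "c = ibinom2 (i - 1)"
  have pos: "a > 0" "b > 0" "c > 0"
    unfolding a_def b_def c_def using Suc.prems by (auto intro!: ibinom2_pos mult_pos_pos)
  have rec: "gam (Suc (Suc k)) i
      = a * gam (Suc k) (i - 1) + b * gam (Suc k) (i - 2) + c * gam (Suc k) (i - 3)"
    unfolding a_def b_def c_def by (rule gam.simps(2))
  have "a * gam (Suc k) (i - 1) \<ge> 0" "b * gam (Suc k) (i - 2) \<ge> 0" "c * gam (Suc k) (i - 3) \<ge> 0"
    using pos nonneg by (simp_all del: gam.simps)
  moreover have "a * gam (Suc k) (i - 1) > 0 \<or> b * gam (Suc k) (i - 2) > 0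
      \<or> c * gam (Suc k) (i - 3) > 0"
  proof -
    \<comment> \<open>The predecessor \<open>i - 1\<close> works until it passes the top index
      \<open>3 * int k + 3\<close>; then \<open>i - 2\<close> and \<open>i - 3\<close> take
      over.\<close>
    consider "i \<le> 3 * int k + 4" | "i = 3 * int k + 5" | "i = 3 * int k + 6"
      using Suc.prems by fastforce
    then show ?thesis
      using Suc.prems pos Suc.IH[of "i - 1"] Suc.IH[of "i - 2"] Suc.IH[of "i - 3"]
      by cases (simp_all del: gam.simps)
  qed
  ultimately show ?case
    unfolding rec by linarith
qed

lemma Suc_times_binomial_Suc_int:
  "(int i + 1) * int (N choose Suc i) = (int N - int i) * int (N choose i)"
proof (cases "i \<le> N")
  case True
  have "Suc i * (N choose Suc i) = (N - i) * (N choose i)"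
    using binomial_absorption[of i N] binomial_absorb_comp[of N i] by simp
  then have "int (Suc i * (N choose Suc i)) = int ((N - i) * (N choose i))"
    by presburger
  then show ?thesis
    using True by (simp add: of_nat_diff algebra_simps)
qed (simp add: binomial_eq_0)

text \<open>Vandermonde for N - k = (i - k) + (N - i) splits binom(N - k, 2) into three terms; the
  factors N - i and binom(N - i, 2) are absorbed by raising the lower index of binom(N, i).\<close>

lemma binomial_times_quadratic:
  "(int N - int k - 1) * (int N - int k) * int (N choose i)
    = 2 * (ibinom2 (int i - int k) * int (N choose i)
      + (int i + 1) * (int i - int k) * int (N choose Suc i)
      + ibinom2 (int i + 2) * int (N choose Suc (Suc i)))"
proof -
  define x y z where "x = int (N choose i)" and "y = int (N choose Suc i)"
    and "z = int (N choose Suc (Suc i))"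
  define p q where "p = ibinom2 (int i - int k)" and "q = ibinom2 (int i + 2)"
  have y: "(int i + 1) * y = (int N - int i) * x"
    unfolding x_def y_def by (rule Suc_times_binomial_Suc_int)
  have z: "(int i + 2) * z = (int N - int i - 1) * y"
    using Suc_times_binomial_Suc_int[of "Suc i" N] unfolding y_def z_def by (simp add: algebra_simps)
  have p: "2 * p = (int i - int k) * (int i - int k - 1)"
    and q: "2 * q = (int i + 2) * (int i + 1)"
    unfolding p_def q_def two_ibinom2 by simp_all
  have "2 * (p * x + (int i + 1) * (int i - int k) * y + q * z)
      = (2 * p) * x + 2 * (int i - int k) * ((int i + 1) * y) + (2 * q) * z"
    by (simp add: algebra_simps)
  also have "(2 * q) * z = (int i + 1) * ((int i + 2) * z)"
    unfolding q by simp
  also have "\<dots> = (int N - int i - 1) * ((int i + 1) * y)"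
    unfolding z by simp
  finally show ?thesis
    unfolding y p x_def[symmetric] y_def[symmetric] z_def[symmetric] p_def[symmetric] q_def[symmetric]
    by (simp add: algebra_simps)
qed

text \<open>Starting at 0 includes the case \<open>k = 0\<close>, where the range from
  \<open>k + 2\<close> to \<open>3 * k\<close> would be empty.\<close>

definition gam_sum :: "nat \<Rightarrow> nat \<Rightarrow> int" where
  "gam_sum k m = (\<Sum>i\<le>3 * k. gam k (int i) * int (m choose i))"

text \<open>Summation by shifting: the recurrence moves from \<open>gam\<close> onto an arbitrary
  weight \<open>h\<close>. All boundary terms fall outside the support of
  \<open>gam k\<close>.\<close>

lemma sum_gam_Suc:
  "(\<Sum>i\<le>3 * k + 2. gam (Suc k) (int i + 1) * h i)
    = (\<Sum>i\<le>3 * k. gam k (int i) * (ibinom2 (int i - int k) * h i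
        + (int i + 1) * (int i - int k) * h (Suc i) + ibinom2 (int i + 2) * h (Suc (Suc i))))"
  (is "?L = ?R")
proof -
  let ?A = "\<lambda>i. ibinom2 (int i - int k) * gam k (int i) * h i"
  let ?B = "\<lambda>i. int i * (int i - 1 - int k) * gam k (int i - 1) * h i"
  let ?C = "\<lambda>i. ibinom2 (int i) * gam k (int i - 2) * h i"
  have *: "gam (Suc k) (int i + 1) * h i = ?A i + ?B i + ?C i" for i
    by (simp add: algebra_simps)
  have "?L = sum ?A {..3 * k + 2} + sum ?B {..3 * k + 2} + sum ?C {..3 * k + 2}"
    unfolding * by (simp only: sum.distrib)
  also have "sum ?A {..3 * k + 2} = sum ?A {..3 * k}"
    by (simp add: gam_eq_0)
  also have "sum ?B {..3 * k + 2} = (\<Sum>i\<le>3 * k. ?B (Suc i))"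
    using sum.atMost_Suc_shift[of ?B "Suc (3 * k)"] by (simp add: gam_eq_0)
  also have "sum ?C {..3 * k + 2} = (\<Sum>i\<le>3 * k. ?C (Suc (Suc i)))"
    using sum.atMost_Suc_shift[of ?C "Suc (3 * k)"] sum.atMost_Suc_shift[of "\<lambda>i. ?C (Suc i)" "3 * k"]
    by (simp add: gam_eq_0)
  also have "sum ?A {..3 * k} + (\<Sum>i\<le>3 * k. ?B (Suc i)) + (\<Sum>i\<le>3 * k. ?C (Suc (Suc i))) = ?R"
    unfolding sum.distrib[symmetric] by (intro sum.cong) (simp_all add: algebra_simps)
  finally show ?thesis .
qed

lemma gam_sum_diff:
  "2 * (gam_sum (Suc k) (Suc N) - gam_sum (Suc k) N) = (int N - int k - 1) * (int N - int k) * gam_sum k N"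
proof -
  let ?g = "\<lambda>i. gam (Suc k) (int i)"
  \<comment> \<open>The term split off does not depend on \<open>m\<close> and cancels in the
    difference; Pascal's rule handles the others.\<close>
  have "gam_sum (Suc k) m = ?g 0 + (\<Sum>i\<le>3 * k + 2. ?g (Suc i) * int (m choose Suc i))" for m
    using sum.atMost_Suc_shift[of "\<lambda>i. ?g i * int (m choose i)" "3 * k + 2"]
    unfolding gam_sum_def by (simp del: gam.simps sum.atMost_Suc add: eval_nat_numeral)
  then have "gam_sum (Suc k) (Suc N) - gam_sum (Suc k) N
      = (\<Sum>i\<le>3 * k + 2. gam (Suc k) (int i + 1) * int (N choose i))"
    by (simp del: gam.simps sum.atMost_Suc add: sum_subtractf[symmetric] algebra_simps)
  moreover have "(int N - int k - 1) * (int N - int k) * gam_sum k N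
      = (\<Sum>i\<le>3 * k. gam k (int i) * ((int N - int k - 1) * (int N - int k) * int (N choose i)))"
    unfolding gam_sum_def sum_distrib_left by (simp only: mult_ac)
  ultimately show ?thesis
    unfolding sum_gam_Suc binomial_times_quadratic by (simp only: sum_distrib_left mult.left_commute)
qed

text \<open>In each term either \<open>i\<close> lies below the support or \<open>i\<close> exceeds
  \<open>m\<close>. The value \<open>m = k + 2\<close> is the case n = 0.\<close>

lemma gam_sum_eq_0:
  assumes "m \<le> k + 2"
  shows "gam_sum (Suc k) m = 0"
  unfolding gam_sum_def
proof (rule sum.neutral, safe)
  fix i
  show "gam (Suc k) (int i) * int (m choose i) = 0"
    using assms gam_eq_0_lower[of "int i" k] by (cases "i < k + 3") (simp_all del: gam.simps)
qed

lemma LS_diag: "LS n n = 1"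
proof -
  have "LS n k = 0" if "n < k" for n k
    using that by (induction n k rule: LS.induct) auto
  then show ?thesis
    by (induction n) auto
qed

lemma LS_eq_gam_sum: "int (LS (n + k) n) = 2 ^ k * gam_sum k (n + k + 1)"
proof (induction k arbitrary: n)
  case 0
  show ?case by (simp add: LS_diag gam_sum_def)
next
  case (Suc k)
  note IH_k = Suc.IH
  show ?case
  proof (induction n)
    case 0
    show ?case by (simp add: gam_sum_eq_0)
  next
    case (Suc n)
    have "int (LS (Suc n + Suc k) (Suc n)) = int (LS (n + Suc k) n)
        + (int n + 1) * (int n + 2) * int (LS (Suc n + k) (Suc n))"
      by (simp add: algebra_simps)
    also have "\<dots> = 2 ^ Suc k * gam_sum (Suc k) (n + k + 2)
        + (int n + 1) * (int n + 2) * (2 ^ k * gam_sum k (n + k + 2))"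
      unfolding Suc.IH IH_k by simp
    also have "\<dots> = 2 ^ Suc k * gam_sum (Suc k) (n + k + 2)
        + 2 ^ k * ((int n + 1) * (int n + 2) * gam_sum k (n + k + 2))"
      by (simp add: algebra_simps)
    \<comment> \<open>This is \<open>gam_sum_diff\<close> at \<open>N = n + k + 2\<close>, where N -
      k - 1 = n + 1 and N - k = n + 2.\<close>
    also have "(int n + 1) * (int n + 2) * gam_sum k (n + k + 2)
        = 2 * (gam_sum (Suc k) (Suc (n + k + 2)) - gam_sum (Suc k) (n + k + 2))"
      unfolding gam_sum_diff by (simp add: algebra_simps)
    finally show ?case
      by (simp add: algebra_simps)
  qed
qed

lemma gam_sum_Suc_eq:
  "gam_sum (Suc k) m = (\<Sum>i=Suc k + 2..3 * Suc k. gam (Suc k) (int i) * int (m choose i))"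
  unfolding gam_sum_def
  by (intro sum.mono_neutral_right) (auto simp del: gam.simps intro!: gam_eq_0_lower)

lemma gam_poly_Suc:
  "gam_poly (Suc k) =
     [:of_nat (k * (k + 1)) / 2, - of_nat k, 1:] * [:0, 1:] * gam_poly k
     - [:of_nat k, of_nat k - 2, - 2:] * [:0, 1:] ^ 2 * pderiv (gam_poly k)
     + smult (1 / 2) ([:1, 1:] ^ 2 * [:0, 1:] ^ 3) * pderiv (pderiv (gam_poly k))"
proof (rule poly_eqI)
  fix j
  have neg: "gam k (- 1) = 0" "gam k (- 2) = 0" "gam k (- 3) = 0"
    by (simp_all add: gam_eq_0)
  have products:
    "[:of_nat (k * (k + 1)) / 2, - of_nat k, 1:] * [:0, 1:]
      = [:0, of_nat (k * (k + 1)) / 2, - of_nat k, 1 :: rat:]"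
    "[:of_nat k, of_nat k - 2, - 2:] * [:0, 1:] ^ 2 = [:0, 0, of_nat k, of_nat k - 2, - 2 :: rat:]"
    "smult (1 / 2) ([:1, 1:] ^ 2 * [:0, 1:] ^ 3) = [:0, 0, 0, 1 / 2, 1, 1 / 2 :: rat:]"
    by (simp_all add: power2_eq_square power3_eq_cube)
  \<comment> \<open>The expanded factors have degree at most 5, so from \<open>j = 5\<close> on the
    coefficient formula is uniform; smaller \<open>j\<close> meet \<open>gam k\<close> at negative
    indices, where it is 0.\<close>
  have "j = 0 \<or> j = 1 \<or> j = 2 \<or> j = 3 \<or> j = 4 \<or> (\<exists>m. j = Suc (Suc (Suc (Suc (Suc m)))))"
    by presburger
  then consider "j = 0" | "j = 1" | "j = 2" | "j = 3" | "j = 4" | m where "j = Suc (Suc (Suc (Suc (Suc m))))"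
    by blast
  then show "coeff (gam_poly (Suc k)) j = coeff (
     [:of_nat (k * (k + 1)) / 2, - of_nat k, 1:] * [:0, 1:] * gam_poly k
     - [:of_nat k, of_nat k - 2, - 2:] * [:0, 1:] ^ 2 * pderiv (gam_poly k)
     + smult (1 / 2) ([:1, 1:] ^ 2 * [:0, 1:] ^ 3) * pderiv (pderiv (gam_poly k))) j"
    unfolding products
    by cases
      (simp_all add: coeff_gam_poly of_int_ibinom2_rat neg coeff_pderiv eval_nat_numeral field_simps)
qed

lemma gam_poly_0: "gam_poly 0 = 1"
  by (rule poly_eqI) (simp add: coeff_gam_poly)

lemma gam_poly_1: "gam_poly 1 = monom 1 3"
  by (rule poly_eqI) (simp add: coeff_gam_poly gam_1 del: gam.simps)

lemma gam_poly_2: "gam_poly 2 = monom 1 4 + monom 8 5 + monom 10 6"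
proof (rule poly_eqI)
  fix j
  have "gam 2 (int j) = (if j = 4 then 1 else if j = 5 then 8 else if j = 6 then 10 else 0)"
    unfolding numeral_2_eq_2 gam.simps(2)[of "Suc 0"] gam_1
    by (auto simp: ibinom2_def)
  then show "coeff (gam_poly 2) j = coeff (monom 1 4 + monom 8 5 + monom 10 6) j"
    by (simp add: coeff_gam_poly)
qed

theorem theorem1:
  shows "(\<forall>k\<ge>1.
           (\<forall>n\<ge>1. int (LS (n + k) n)
              = 2 ^ k * (\<Sum>i=k+2..3*k. gam k (int i) * int ((n + k + 1) choose i))) \<and>
           (\<forall>i::int. int k + 2 \<le> i \<and> i \<le> 3 * int k \<longrightarrow> gam k i > 0)) \<and>
         (\<forall>k. gam_poly (k + 1) =
           [:of_nat (k * (k + 1)) / 2, - of_nat k, 1:] * [:0, 1:] * gam_poly k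
           - [:of_nat k, of_nat k - 2, - 2:] * [:0, 1:] ^ 2 * pderiv (gam_poly k)
           + smult (1 / 2) ([:1, 1:] ^ 2 * [:0, 1:] ^ 3) * pderiv (pderiv (gam_poly k))) \<and>
         gam_poly 0 = 1 \<and>
         gam_poly 1 = monom 1 3 \<and>
         gam_poly 2 = monom 1 4 + monom 8 5 + monom 10 6"
proof (intro conjI allI impI)
  fix k n :: nat
  assume "k \<ge> 1" "n \<ge> 1"
  then obtain l where "k = Suc l"
    by (cases k) auto
  then show "int (LS (n + k) n) = 2 ^ k * (\<Sum>i=k+2..3*k. gam k (int i) * int ((n + k + 1) choose i))"
    using LS_eq_gam_sum[of n k] gam_sum_Suc_eq by metis
next
  fix k :: nat and i :: int
  assume "k \<ge> 1" "int k + 2 \<le> i \<and> i \<le> 3 * int k"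
  then show "gam k i > 0"
    using gam_pos[of "k - 1" i] by (simp del: gam.simps)
next
  fix k :: nat
  show "gam_poly (k + 1) =
      [:of_nat (k * (k + 1)) / 2, - of_nat k, 1:] * [:0, 1:] * gam_poly k
      - [:of_nat k, of_nat k - 2, - 2:] * [:0, 1:] ^ 2 * pderiv (gam_poly k)
      + smult (1 / 2) ([:1, 1:] ^ 2 * [:0, 1:] ^ 3) * pderiv (pderiv (gam_poly k))"
    by (fact gam_poly_Suc[unfolded Suc_eq_plus1])
qed (fact gam_poly_0 gam_poly_1 gam_poly_2)+

end
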